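(* Let $D_0$ be a diagram. Suppose there exist a diagram $D\in KD(D_0)$ and positive integers $r,r',r_1,r_2,c,c'$ with $1\le r_1,r_2<r<r'$ and $1\le c<c'$ such that: (1) $(\tilde r,c)\in D$ for all $r\le\tilde r\le r'$, and $(r,c')\in D$; (2) $(r',\tilde c)\notin D$ for all $\tilde c>c$; (3) for each $\tilde r$ with $r<\tilde r<r'$ there exists $\tilde c>c$ with $(\tilde r,\tilde c)\in D$; (4) $(r,\tilde c)\notin D$ for all $\tilde c$ with $c<\tilde c<c'$ and for all $\tilde c>c'$; (5) $(r_1,c)\notin D$ and $(r_2,c')\notin D$. Then $\mathcal{P}(D_0)$ is not ranked.
   Context: A diagram is a finite set $D$ of cells $(r,c)$ with $r,c$ positive integers; $r$ is the row (rows numbered from bottom to top starting at 1) and $c$ the column (numbered from left to right starting at 1). A Kohnert move at row $r$ applied to a diagram $D$: if row $r$ of $D$ is empty, $D$ is unchanged; otherwise let $(r,c)$ be the cell of row $r$ with the largest column index; if every position $(r',c)$ with $1\le r'<r$ belongs to $D$, then $D$ is unchanged; otherwise let $r'$ be the largest integer with $1\le r'<r$ and $(r',c)\notin D$, and the move replaces the cell $(r,c)$ by $(r',c)$. For a diagram $D_0$, $KD(D_0)$ is the set of all diagrams obtainable from $D_0$ by finite (possibly empty) sequences of Kohnert moves. The Kohnert poset $\mathcal{P}(D_0)$ is $KD(D_0)$ ordered by $D_2\preceq D_1$ iff $D_2$ can be obtained from $D_1$ by a finite sequence of Kohnert moves. A finite poset $P$ is ranked if there is a function $\rho:P\to\mathbb{Z}_{\ge0}$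 such that $x\prec y$ implies $\rho(x)<\rho(y)$ and $\rho(y)=\rho(x)+1$ whenever $y$ covers $x$. *)

theory Defs
  imports Main
begin

text \<open>A cell is a pair (row, column). Rows are numbered from bottom to top and columns from
  left to right, both starting at 1, so positivity of the coordinates is part of being a diagram.\<close>

type_synonym cell = "nat \<times> nat"

definition diagram :: "cell set \<Rightarrow> bool" where
  "diagram D \<longleftrightarrow> finite D \<and> (\<forall>(r, c) \<in> D. 1 \<le> r \<and> 1 \<le> c)"

definition row_columns :: "cell set \<Rightarrow> nat \<Rightarrow> nat set" where
  "row_columns D r = {c. (r, c) \<in> D}"

definition free_rows_below :: "cell set \<Rightarrow> nat \<Rightarrow> nat \<Rightarrow> nat set" where
  "free_rows_below D r c = {r'. 1 \<le> r' \<and> r' < r \<and> (r', c) \<notin> D}"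

definition kohnert_move :: "nat \<Rightarrow> cell set \<Rightarrow> cell set" where
  "kohnert_move r D =
    (if row_columns D r = {} then D
     else let c = Max (row_columns D r) in
       if free_rows_below D r c = {} then D
       else insert (Max (free_rows_below D r c), c) (D - {(r, c)}))"

definition kohnert_step :: "cell set \<Rightarrow> cell set \<Rightarrow> bool" where
  "kohnert_step D E \<longleftrightarrow> (\<exists>r \<ge> 1. E = kohnert_move r D)"

definition KD :: "cell set \<Rightarrow> cell set set" where
  "KD D\<^sub>0 = {D. kohnert_step\<^sup>*\<^sup>* D\<^sub>0 D}"

text \<open>A poset is given by its carrier and its (reflexive) order relation, as in
  \<^const>\<open>partial_order_on\<close>: a pair \<open>(x, y)\<close> in the relation means that \<open>x\<close> is below \<open>y\<close>.
  Thus a pair \<open>(D\<^sub>2, D\<^sub>1)\<close> below means that \<open>D\<^sub>2\<close> is reached from \<open>D\<^sub>1\<close>.\<close>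

definition kohnert_order :: "cell set \<Rightarrow> cell set rel" where
  "kohnert_order D\<^sub>0 = {(D\<^sub>2, D\<^sub>1). D\<^sub>1 \<in> KD D\<^sub>0 \<and> D\<^sub>2 \<in> KD D\<^sub>0 \<and> kohnert_step\<^sup>*\<^sup>* D\<^sub>1 D\<^sub>2}"

definition strictly_below :: "'a rel \<Rightarrow> 'a \<Rightarrow> 'a \<Rightarrow> bool" where
  "strictly_below R x y \<longleftrightarrow> (x, y) \<in> R \<and> x \<noteq> y"

definition covered_by :: "'a set \<Rightarrow> 'a rel \<Rightarrow> 'a \<Rightarrow> 'a \<Rightarrow> bool" where
  "covered_by P R x y \<longleftrightarrow>
    strictly_below R x y \<and> \<not> (\<exists>z \<in> P. strictly_below R x z \<and> strictly_below R z y)"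

text \<open>Being a finite poset is deliberately not a conjunct here, so that not being ranked always
  means that no rank function exists. For Kohnert posets it holds, see \<open>partial_order_kohnert\<close>
  and \<open>finite_KD\<close>.\<close>

definition ranked :: "'a set \<Rightarrow> 'a rel \<Rightarrow> bool" where
  "ranked P R \<longleftrightarrow> (\<exists>\<rho> :: 'a \<Rightarrow> nat.
    (\<forall>x \<in> P. \<forall>y \<in> P. strictly_below R x y \<longrightarrow> \<rho> x < \<rho> y) \<and>
    (\<forall>x \<in> P. \<forall>y \<in> P. covered_by P R x y \<longrightarrow> \<rho> y = \<rho> x + 1))"

lemma kohnert_move_cases:
  assumes "diagram D"
  obtains "kohnert_move r D = D"
  | r' c where "(r, c) \<in> D" "1 \<le> r'" "r' < r" "(r', c) \<notin> D"
      "kohnert_move r D = insert (r', c) (D - {(r, c)})"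
proof (cases "kohnert_move r D = D")
  case True
  then show thesis by (rule that(1))
next
  case False
  define c where "c = Max (row_columns D r)"
  define r' where "r' = Max (free_rows_below D r c)"
  have ne: "row_columns D r \<noteq> {}" "free_rows_below D r c \<noteq> {}"
    and eq: "kohnert_move r D = insert (r', c) (D - {(r, c)})"
    using False unfolding kohnert_move_def c_def r'_def Let_def by (auto split: if_splits)
  have "finite (row_columns D r)"
    using assms finite_vimageI[of D "Pair r"]
    unfolding row_columns_def diagram_def vimage_def by (simp add: inj_on_def)
  then have "c \<in> row_columns D r" unfolding c_def using ne(1) by (rule Max_in)
  moreover have "finite (free_rows_below D r c)"
    by (rule finite_subset[of _ "{..<r}"]) (auto simp: free_rows_below_def)
  then have "r' \<in> free_rows_below D r c" unfolding r'_def using ne(2) by (rule Max_in)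
  ultimately show thesis
    using that(2)[of c r'] eq unfolding row_columns_def free_rows_below_def by simp
qed

lemma kohnert_step_diagram:
  assumes "diagram D" "kohnert_step D E"
  shows "diagram E \<and> (E = D \<or> sum fst E < sum fst D) \<and> E \<subseteq> {..Max (insert 0 (fst ` D))} \<times> snd ` D"
proof -
  have fin: "finite D" using assms(1) by (simp add: diagram_def)
  have le: "fst x \<le> Max (insert 0 (fst ` D))" if "x \<in> D" for x
    using that fin by (intro Max_ge) auto
  have sub: "D \<subseteq> {..Max (insert 0 (fst ` D))} \<times> snd ` D"
    using le by force
  obtain r where E: "E = kohnert_move r D"
    using assms(2) by (auto simp: kohnert_step_def)
  show ?thesis
  proof (cases rule: kohnert_move_cases[OF assms(1), of r])
    case 1
    then show ?thesis using E assms(1) sub by simp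
  next
    case (2 r' c)
    have "sum fst E = r' + sum fst (D - {(r, c)})" using 2 E fin by simp
    moreover have "sum fst D = r + sum fst (D - {(r, c)})"
      using sum.remove[OF fin 2(1), of fst] by simp
    moreover have "diagram E" using assms(1) 2 E by (auto simp: diagram_def)
    moreover have "(r', c) \<in> {..Max (insert 0 (fst ` D))} \<times> snd ` D"
      using le[OF 2(1)] 2(1,3) by force
    ultimately show ?thesis using 2(3,5) E sub by auto
  qed
qed

lemma kohnert_steps_diagram:
  assumes "kohnert_step\<^sup>*\<^sup>* D E" "diagram D"
  shows "diagram E \<and> (E = D \<or> sum fst E < sum fst D)"
  using assms
proof (induction rule: rtranclp_induct)
  case base
  then show ?case by simp
next
  case (step E F)
  then have E: "diagram E" "E = D \<or> sum fst E < sum fst D" by simp_all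
  then show ?case using kohnert_step_diagram[OF E(1) step(2)] by (metis less_trans)
qed

lemma diagram_KD: "diagram D\<^sub>0 \<Longrightarrow> D \<in> KD D\<^sub>0 \<Longrightarrow> diagram D"
  using kohnert_steps_diagram[of D\<^sub>0 D] by (simp add: KD_def)

lemma finite_KD:
  assumes "diagram D\<^sub>0"
  shows "finite (KD D\<^sub>0)"
proof -
  let ?m = "\<lambda>D :: cell set. Max (insert 0 (fst ` D))"
  let ?B = "{..?m D\<^sub>0} \<times> snd ` D\<^sub>0"
  have fin: "finite D\<^sub>0" using assms by (simp add: diagram_def)
  have "E \<subseteq> ?B" if "kohnert_step\<^sup>*\<^sup>* D\<^sub>0 E" for E
    using that
  proof (induction rule: rtranclp_induct)
    case base
    have "fst x \<le> ?m D\<^sub>0" if "x \<in> D\<^sub>0" for x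
      using that fin by (intro Max_ge) auto
    then show ?case by force
  next
    case (step D E)
    have D: "diagram D" using kohnert_steps_diagram[OF step(1) assms] by simp
    then have "finite D" by (simp add: diagram_def)
    moreover have "fst ` D \<subseteq> {..?m D\<^sub>0}" "snd ` D \<subseteq> snd ` D\<^sub>0" using step(3) by force+
    ultimately have "?m D \<le> ?m D\<^sub>0" by (subst Max.bounded_iff) auto
    then have "{..?m D} \<times> snd ` D \<subseteq> ?B" using \<open>snd ` D \<subseteq> snd ` D\<^sub>0\<close> by (intro Sigma_mono) auto
    then show ?case using kohnert_step_diagram[OF D step(2)] by blast
  qed
  then have "KD D\<^sub>0 \<subseteq> Pow ?B" by (auto simp only: KD_def)
  then show ?thesis by (rule finite_subset) (simp add: fin)
qed

lemma partial_order_kohnert: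
  assumes "diagram D\<^sub>0"
  shows "partial_order_on (KD D\<^sub>0) (kohnert_order D\<^sub>0)"
proof -
  have "antisym (kohnert_order D\<^sub>0)"
  proof (rule antisymI)
    fix x y
    assume "(x, y) \<in> kohnert_order D\<^sub>0" "(y, x) \<in> kohnert_order D\<^sub>0"
    then have xy: "kohnert_step\<^sup>*\<^sup>* x y" "kohnert_step\<^sup>*\<^sup>* y x" "x \<in> KD D\<^sub>0" "y \<in> KD D\<^sub>0"
      unfolding kohnert_order_def by blast+
    have "x = y \<or> sum fst y < sum fst x" "y = x \<or> sum fst x < sum fst y"
      using kohnert_steps_diagram[OF xy(1) diagram_KD[OF assms xy(3)]]
        kohnert_steps_diagram[OF xy(2) diagram_KD[OF assms xy(4)]] by blast+
    then show "x = y" using less_asym by blast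
  qed
  moreover have "trans (kohnert_order D\<^sub>0)"
  proof (rule transI)
    fix x y z
    assume "(x, y) \<in> kohnert_order D\<^sub>0" "(y, z) \<in> kohnert_order D\<^sub>0"
    then show "(x, z) \<in> kohnert_order D\<^sub>0"
      unfolding kohnert_order_def mem_Collect_eq case_prod_conv by (blast intro: rtranclp_trans)
  qed
  moreover have "kohnert_order D\<^sub>0 \<subseteq> KD D\<^sub>0 \<times> KD D\<^sub>0"
    unfolding kohnert_order_def by blast
  moreover have "refl_on (KD D\<^sub>0) (kohnert_order D\<^sub>0)"
    unfolding refl_on_def kohnert_order_def by blast
  ultimately show ?thesis
    unfolding partial_order_on_def preorder_on_def by blast
qed

end

theory Submission
  imports Defs
begin

text \<open>Performing moves in rows below \<open>r\<close> affects none of the hypotheses, so we may assume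
  that all of these moves are trivial. Let \<open>s\<close> and \<open>t\<close> be the highest gaps below row \<open>r\<close> in the
  columns \<open>c\<close> and \<open>c'\<close>, and let \<open>E\<close> arise from \<open>D\<close> by dropping \<open>(r', c)\<close> to \<open>(s, c)\<close> and \<open>(r, c')\<close>
  to \<open>(t, c')\<close>. Moving row \<open>r'\<close> and then row \<open>r\<close> leads from \<open>D\<close> to \<open>E\<close> in two steps, and both are
  covers because every cell passed over has a cell to its right. Moving row \<open>r\<close> twice and then
  row \<open>r'\<close> leads from \<open>D\<close> to \<open>E\<close> in three steps.\<close>

section \<open>Single Kohnert moves as drops within a column\<close>

definition drop_cell :: "nat \<Rightarrow> nat \<Rightarrow> nat \<Rightarrow> cell set \<Rightarrow> cell set" where
  "drop_cell c a b D = insert (b, c) (D - {(a, c)})"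

lemma mem_drop_cell:
  "(s, d) \<in> drop_cell c a b D \<longleftrightarrow> (s, d) = (b, c) \<or> (s, d) \<in> D \<and> (s, d) \<noteq> (a, c)"
  by (auto simp: drop_cell_def)

lemma kohnert_move_eq_drop_cell:
  assumes "(a, c) \<in> D" "\<And>d. c < d \<Longrightarrow> (a, d) \<notin> D"
    and "1 \<le> b" "b < a" "(b, c) \<notin> D" "\<And>s. b < s \<Longrightarrow> s < a \<Longrightarrow> (s, c) \<in> D"
  shows "kohnert_move a D = drop_cell c a b D"
proof -
  have le: "d \<le> c" if "d \<in> row_columns D a" for d
    using that assms(2)[of d] by (force simp: row_columns_def)
  then have "finite (row_columns D a)"
    by (meson atMost_iff finite_atMost finite_subset subsetI)
  then have 1: "Max (row_columns D a) = c"
    using le assms(1) by (intro Max_eqI) (auto simp: row_columns_def)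
  have 2: "Max (free_rows_below D a c) = b"
  proof (rule Max_eqI)
    show "finite (free_rows_below D a c)"
      by (rule finite_subset[of _ "{..<a}"]) (auto simp: free_rows_below_def)
    show "s \<le> b" if "s \<in> free_rows_below D a c" for s
      using that assms(6)[of s] by (force simp: free_rows_below_def)
    show "b \<in> free_rows_below D a c"
      using assms by (auto simp: free_rows_below_def)
  qed
  have "row_columns D a \<noteq> {}" "free_rows_below D a c \<noteq> {}"
    using assms by (auto simp: row_columns_def free_rows_below_def)
  then show ?thesis
    by (simp add: kohnert_move_def 1 2 drop_cell_def)
qed

text \<open>In contrast to \<open>kohnert_move_cases\<close>, this keeps the fact that the moved
  cell is the rightmost of its row, which later rules out moves of passed-over cells.\<close>

lemma kohnert_move_drop_cellE:
  assumes "diagram D" "kohnert_move a D \<noteq> D"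
  obtains b c where "(a, c) \<in> D" "\<And>d. c < d \<Longrightarrow> (a, d) \<notin> D"
    "1 \<le> b" "b < a" "(b, c) \<notin> D" "kohnert_move a D = drop_cell c a b D"
proof -
  define c where "c = Max (row_columns D a)"
  define b where "b = Max (free_rows_below D a c)"
  have ne: "row_columns D a \<noteq> {}" "free_rows_below D a c \<noteq> {}"
    and eq: "kohnert_move a D = drop_cell c a b D"
    using assms(2) unfolding kohnert_move_def c_def b_def Let_def drop_cell_def
    by (auto split: if_splits)
  have fin: "finite (row_columns D a)"
    using assms(1) finite_vimageI[of D "Pair a"]
    unfolding row_columns_def diagram_def vimage_def by (simp add: inj_on_def)
  have "c \<in> row_columns D a" unfolding c_def using fin ne(1) by (rule Max_in)
  moreover have "d \<le> c" if "(a, d) \<in> D" for d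
    unfolding c_def using fin that by (intro Max_ge) (auto simp: row_columns_def)
  moreover have "finite (free_rows_below D a c)"
    by (rule finite_subset[of _ "{..<a}"]) (auto simp: free_rows_below_def)
  then have "b \<in> free_rows_below D a c" unfolding b_def using ne(2) by (rule Max_in)
  ultimately show ?thesis
    using that[of c b] eq unfolding row_columns_def free_rows_below_def
    by (auto simp: not_le[symmetric])
qed

lemma highest_gap:
  fixes D :: "cell set"
  assumes "1 \<le> b" "b < a" "(b, c) \<notin> D"
  obtains s where "1 \<le> s" "s < a" "(s, c) \<notin> D" "\<And>t. s < t \<Longrightarrow> t < a \<Longrightarrow> (t, c) \<in> D"
proof -
  let ?P = "\<lambda>s. 1 \<le> s \<and> s < a \<and> (s, c) \<notin> D"
  define s where "s = (GREATEST s. ?P s)"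
  have "?P s" unfolding s_def
    by (rule GreatestI_nat[of ?P b a]) (use assms in auto)
  moreover have "t \<le> s" if "?P t" for t unfolding s_def
    by (rule Greatest_le_nat[of ?P t a]) (use that in auto)
  ultimately show ?thesis
    using that[of s] by (metis le_less_trans less_imp_le not_le)
qed

text \<open>A rightmost cell with a gap below it would fall into the highest such gap, so the move
  would change \<open>D\<close>. Once the rows below \<open>r\<close> are settled, this supplies the
  right neighbours that a cover requires.\<close>

lemma right_neighbour_if_move_trivial:
  assumes "kohnert_move a D = D" "(a, c) \<in> D" "1 \<le> b" "b < a" "(b, c) \<notin> D"
  shows "\<exists>d > c. (a, d) \<in> D"
proof (rule ccontr)
  assume right: "\<not> (\<exists>d > c. (a, d) \<in> D)"
  obtain s where s: "1 \<le> s" "s < a" "(s, c) \<notin> D" "\<And>t. s < t \<Longrightarrow> t < a \<Longrightarrow> (t, c) \<in> D"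
    using highest_gap[OF assms(3-5)] by blast
  then have "kohnert_move a D = drop_cell c a s D"
    using assms(2) right by (intro kohnert_move_eq_drop_cell) auto
  then have "(s, c) \<in> D" using assms(1) by (metis mem_drop_cell)
  then show False using s(3) by contradiction
qed

section \<open>Exhausting the moves below a given row\<close>

lemma row_pos:
  assumes "diagram D" "(a, c) \<in> D"
  shows "1 \<le> a"
  using assms by (auto simp: diagram_def)

text \<open>Nontrivial moves in rows below \<open>r\<close> are performed until none is left; this
  terminates because each one lowers the sum of the row indices. Such moves stay below row
  \<open>r\<close>, and a column never loses all its gaps there, since a move opens a gap where it
  closes one.\<close>

lemma settle_rows_below:
  assumes "diagram D"
  obtains E where "kohnert_step\<^sup>*\<^sup>* D E"
    "\<And>s d. r \<le> s \<Longrightarrow> (s, d) \<in> E \<longleftrightarrow> (s, d) \<in> D"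
    "\<And>s. s < r \<Longrightarrow> kohnert_move s E = E"
    "\<And>s d. 1 \<le> s \<Longrightarrow> s < r \<Longrightarrow> (s, d) \<notin> D \<Longrightarrow> \<exists>t. 1 \<le> t \<and> t < r \<and> (t, d) \<notin> E"
  using assms
proof (induction "sum fst D" arbitrary: D thesis rule: less_induct)
  case less
  show ?case
  proof (cases "\<forall>s < r. kohnert_move s D = D")
    case True
    then show ?thesis by (intro less.prems(1)[of D]) auto
  next
    case False
    then obtain a where a: "a < r" "kohnert_move a D \<noteq> D" by blast
    then obtain b c where m: "(a, c) \<in> D" "1 \<le> b" "b < a" "(b, c) \<notin> D"
        "kohnert_move a D = drop_cell c a b D"
      using kohnert_move_drop_cellE[OF less.prems(2)] by metis
    let ?F = "drop_cell c a b D"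
    have a1: "1 \<le> a" using row_pos[OF less.prems(2) m(1)] .
    have step: "kohnert_step D ?F"
      using a1 m(5) by (auto simp: kohnert_step_def intro!: exI[of _ a])
    have F: "diagram ?F" "sum fst ?F < sum fst D"
      using kohnert_step_diagram[OF less.prems(2) step] a(2) m(5) by auto
    obtain E where E: "kohnert_step\<^sup>*\<^sup>* ?F E"
      "\<And>s d. r \<le> s \<Longrightarrow> (s, d) \<in> E \<longleftrightarrow> (s, d) \<in> ?F"
      "\<And>s. s < r \<Longrightarrow> kohnert_move s E = E"
      "\<And>s d. 1 \<le> s \<Longrightarrow> s < r \<Longrightarrow> (s, d) \<notin> ?F \<Longrightarrow> \<exists>t. 1 \<le> t \<and> t < r \<and> (t, d) \<notin> E"
      using less.hyps[OF F(2) _ F(1)] by metis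
    show ?thesis
    proof (rule less.prems(1)[of E])
      show "kohnert_step\<^sup>*\<^sup>* D E" using step E(1) by (rule converse_rtranclp_into_rtranclp)
      show "(s, d) \<in> E \<longleftrightarrow> (s, d) \<in> D" if "r \<le> s" for s d
        using E(2)[OF that] that a(1) m(3) by (auto simp: mem_drop_cell)
      show "kohnert_move s E = E" if "s < r" for s using E(3)[OF that] .
      show "\<exists>t. 1 \<le> t \<and> t < r \<and> (t, d) \<notin> E" if "1 \<le> s" "s < r" "(s, d) \<notin> D" for s d
      proof (cases "d = c")
        case True
        \<comment> \<open>The gap at \<open>(s, c)\<close> may be the one just filled, so the
          vacated position \<open>(a, c)\<close> serves as the gap instead.\<close>
        have "(a, c) \<notin> ?F" using m(3) by (simp add: mem_drop_cell)
        then show ?thesis using E(4)[OF a1 a(1)] True by simp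
      next
        case False
        then show ?thesis using E(4)[OF that(1,2), of d] that(3) by (simp add: mem_drop_cell)
      qed
    qed
  qed
qed

section \<open>Column counts and covering relations\<close>

text \<open>Cells only move down, so these counts never decrease along a descent and restrict which
  moves can lead to a given diagram.\<close>

definition cells_upto :: "nat \<Rightarrow> nat \<Rightarrow> cell set \<Rightarrow> nat" where
  "cells_upto s d D = card {t. t \<le> s \<and> (t, d) \<in> D}"

text \<open>For \<open>s\<close> below \<open>b\<close> neither end of the drop is counted, and from
  \<open>a\<close> on both are; only in between is a cell gained.\<close>

lemma cells_upto_drop_cell:
  assumes "(a, c) \<in> D" "(b, c) \<notin> D" "b < a"
  shows "cells_upto s d (drop_cell c a b D) =
    cells_upto s d D + (if d = c \<and> b \<le> s \<and> s < a then 1 else 0)"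
proof -
  let ?A = "{t. t \<le> s \<and> (t, d) \<in> D}" and ?B = "{t. t \<le> s \<and> (t, d) \<in> drop_cell c a b D}"
  have fin: "finite ?A" by (rule finite_subset[of _ "{..s}"]) auto
  consider "d \<noteq> c \<or> s < b" | "d = c" "b \<le> s" "s < a" | "d = c" "a \<le> s" by linarith
  then show ?thesis
  proof cases
    case 1
    then have "?B = ?A" using assms(3) by (auto simp: mem_drop_cell)
    then show ?thesis using 1 unfolding cells_upto_def by auto
  next
    case 2
    then have "?B = insert b ?A" by (auto simp: mem_drop_cell)
    then show ?thesis using 2 fin assms(2) unfolding cells_upto_def by simp
  next
    case 3
    then have "?B = insert b (?A - {a})" using assms(3) by (auto simp: mem_drop_cell)
    moreover have "card (insert b (?A - {a})) = card ?A"
      using card.remove[OF fin, of a] 3 fin assms by simp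
    ultimately show ?thesis using 3 unfolding cells_upto_def by simp
  qed
qed

lemma cells_upto_mono:
  assumes "kohnert_step\<^sup>*\<^sup>* D E" "diagram D"
  shows "cells_upto s d D \<le> cells_upto s d E"
  using assms(1)
proof (induction rule: rtranclp_induct)
  case (step E F)
  have E: "diagram E" using kohnert_steps_diagram[OF step(1) assms(2)] by simp
  obtain a where a: "F = kohnert_move a E" using step(2) by (auto simp: kohnert_step_def)
  have "cells_upto s d E \<le> cells_upto s d F"
  proof (cases "kohnert_move a E = E")
    case False
    then show ?thesis
      by (elim kohnert_move_drop_cellE[OF E]) (simp add: a cells_upto_drop_cell)
  qed (simp add: a)
  then show ?case using step(3) by simp
qed simp

text \<open>Along any descent from \<open>D\<close> to the dropped diagram the column counts are squeezed so tightly
  that the first proper step can only be the drop itself.\<close>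

lemma drop_cell_no_intermediate:
  assumes D: "diagram D" "(a, c) \<in> D" "b < a" "(b, c) \<notin> D"
    and full: "\<And>s. b < s \<Longrightarrow> s < a \<Longrightarrow> (s, c) \<in> D"
    and right: "\<And>s. b < s \<Longrightarrow> s < a \<Longrightarrow> \<exists>d > c. (s, d) \<in> D"
    and Z: "kohnert_step\<^sup>*\<^sup>* D Z" "kohnert_step\<^sup>*\<^sup>* Z (drop_cell c a b D)"
  shows "Z = D \<or> Z = drop_cell c a b D"
proof -
  let ?F = "drop_cell c a b D"
  have first: "W = D \<or> W = ?F" if W: "kohnert_step D W" "kohnert_step\<^sup>*\<^sup>* W ?F" for W
  proof -
    obtain x where x: "W = kohnert_move x D" using W(1) by (auto simp: kohnert_step_def)
    show ?thesis
    proof (cases "W = D")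
      case False
      then obtain y e where m: "(x, e) \<in> D" "\<And>d. e < d \<Longrightarrow> (x, d) \<notin> D"
          "y < x" "(y, e) \<notin> D" "W = drop_cell e x y D"
        using kohnert_move_drop_cellE[OF D(1), of x] x by metis
      have dW: "diagram W" using kohnert_step_diagram[OF D(1) W(1)] by simp
      \<comment> \<open>The move to \<open>W\<close> raises the count of column \<open>e\<close> at
        every level from \<open>y\<close> to \<open>x - 1\<close>. Monotonicity forces
        \<open>?F\<close> to have this gain too, but \<open>?F\<close> gains only in column
        \<open>c\<close> at levels from \<open>b\<close> to \<open>a - 1\<close>.\<close>
      have *: "e = c \<and> b \<le> s \<and> s < a" if "y \<le> s" "s < x" for s
        using cells_upto_mono[OF W(2) dW, of s e] that
          cells_upto_drop_cell[OF m(1,4,3), of s e] cells_upto_drop_cell[OF D(2,4,3), of s e]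
        unfolding m(5) by (auto split: if_splits)
      have ec: "e = c" and y: "b \<le> y" "y < a" using *[of y] m(3) by auto
      have "y \<le> x - 1" "x - 1 < x" using m(3) by linarith+
      then have "x \<le> a" using *[of "x - 1"] by linarith
      \<comment> \<open>The target \<open>y\<close> is a gap, and column \<open>c\<close> has none
        strictly between \<open>b\<close> and \<open>a\<close>.\<close>
      moreover have "y = b" using full[of y] y m(4) ec by force
      \<comment> \<open>A source strictly between \<open>b\<close> and \<open>a\<close> has a cell
        to its right, so it is not the rightmost of its row.\<close>
      moreover have "\<not> x < a" using right[of x] m(2,3) ec \<open>y = b\<close> by blast
      ultimately show ?thesis using m(5) ec by simp
    qed simp
  qed
  \<comment> \<open>A path stays at \<open>D\<close> until its first proper step, which by
    \<open>first\<close> lands on \<open>?F\<close>.\<close>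
  have "Z = D \<or> kohnert_step\<^sup>*\<^sup>* ?F Z"
    using Z
  proof (induction rule: rtranclp_induct)
    case (step Y Z)
    then have "Y = D \<or> kohnert_step\<^sup>*\<^sup>* ?F Y"
      by (meson converse_rtranclp_into_rtranclp)
    then show ?case
    proof
      assume "Y = D"
      then show ?case using first[of Z] step by auto
    next
      assume "kohnert_step\<^sup>*\<^sup>* ?F Y"
      then show ?case using step(2) by (auto intro: rtranclp.rtrancl_into_rtrancl)
    qed
  qed simp
  \<comment> \<open>Mutual reachability would otherwise strictly decrease the row sum in both
    directions.\<close>
  moreover have "Z = ?F" if FZ: "kohnert_step\<^sup>*\<^sup>* ?F Z"
  proof -
    have dZ: "diagram Z" using kohnert_steps_diagram[OF Z(1) D(1)] by simp
    have dF: "diagram ?F" using kohnert_steps_diagram[OF Z(2) dZ] by simp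
    show ?thesis
      using kohnert_steps_diagram[OF FZ dF] kohnert_steps_diagram[OF Z(2) dZ] by auto
  qed
  ultimately show ?thesis by blast
qed

lemma strictly_below_drop_cell:
  assumes D: "diagram D\<^sub>0" "D \<in> KD D\<^sub>0"
    and "(a, c) \<in> D" "\<And>d. c < d \<Longrightarrow> (a, d) \<notin> D"
    and "1 \<le> b" "b < a" "(b, c) \<notin> D" "\<And>s. b < s \<Longrightarrow> s < a \<Longrightarrow> (s, c) \<in> D"
  shows "strictly_below (kohnert_order D\<^sub>0) (drop_cell c a b D) D"
proof -
  have "1 \<le> a" using row_pos[OF diagram_KD[OF D] assms(3)] .
  then have step: "kohnert_step D (drop_cell c a b D)"
    using kohnert_move_eq_drop_cell[OF assms(3-8)]
    by (auto simp: kohnert_step_def intro!: exI[of _ a])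
  have "drop_cell c a b D \<in> KD D\<^sub>0"
    using D(2) step unfolding KD_def mem_Collect_eq by (rule rtranclp.rtrancl_into_rtrancl)
  moreover have "(b, c) \<in> drop_cell c a b D" by (simp add: mem_drop_cell)
  then have "drop_cell c a b D \<noteq> D" using assms(7) by blast
  ultimately show ?thesis
    using D(2) r_into_rtranclp[of kohnert_step, OF step]
    by (simp add: strictly_below_def kohnert_order_def)
qed

lemma strictly_below_kohnert_order_KD:
  "strictly_below (kohnert_order D\<^sub>0) x y \<Longrightarrow> x \<in> KD D\<^sub>0"
  by (simp add: strictly_below_def kohnert_order_def)

text \<open>The right neighbours prevent the drop from being split, with a passed-over cell falling
  to \<open>b\<close> first and the cell from \<open>a\<close> then taking its place.\<close>

lemma covered_by_drop_cell:
  assumes D: "diagram D\<^sub>0" "D \<in> KD D\<^sub>0"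
    and "(a, c) \<in> D" "\<And>d. c < d \<Longrightarrow> (a, d) \<notin> D"
    and "1 \<le> b" "b < a" "(b, c) \<notin> D" "\<And>s. b < s \<Longrightarrow> s < a \<Longrightarrow> (s, c) \<in> D"
    and "\<And>s. b < s \<Longrightarrow> s < a \<Longrightarrow> \<exists>d > c. (s, d) \<in> D"
  shows "covered_by (KD D\<^sub>0) (kohnert_order D\<^sub>0) (drop_cell c a b D) D"
proof -
  have "Z = D \<or> Z = drop_cell c a b D"
    if "kohnert_step\<^sup>*\<^sup>* D Z" "kohnert_step\<^sup>*\<^sup>* Z (drop_cell c a b D)" for Z
    by (rule drop_cell_no_intermediate[OF diagram_KD[OF D] assms(3,6-9) that])
  then show ?thesis
    using strictly_below_drop_cell[OF assms(1-8)]
    by (auto simp: covered_by_def strictly_below_def kohnert_order_def)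
qed

section \<open>Two chains of different lengths with the same ends\<close>

theorem theorem3p4:
  fixes D\<^sub>0 D :: "cell set"
    and r r' r\<^sub>1 r\<^sub>2 c c' :: nat
  assumes "diagram D\<^sub>0"
    and "D \<in> KD D\<^sub>0"
    and "1 \<le> r\<^sub>1" "r\<^sub>1 < r" "1 \<le> r\<^sub>2" "r\<^sub>2 < r" "r < r'"
    and "1 \<le> c" "c < c'"
    and "\<forall>s. r \<le> s \<and> s \<le> r' \<longrightarrow> (s, c) \<in> D"
    and "(r, c') \<in> D"
    and "\<forall>d > c. (r', d) \<notin> D"
    and "\<forall>s. r < s \<and> s < r' \<longrightarrow> (\<exists>d > c. (s, d) \<in> D)"
    and "\<forall>d. c < d \<and> d < c' \<or> c' < d \<longrightarrow> (r, d) \<notin> D"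
    and "(r\<^sub>1, c) \<notin> D" "(r\<^sub>2, c') \<notin> D"
  shows "\<not> ranked (KD D\<^sub>0) (kohnert_order D\<^sub>0)"
proof -
  obtain D' where D': "kohnert_step\<^sup>*\<^sup>* D D'"
    "\<And>s d. r \<le> s \<Longrightarrow> (s, d) \<in> D' \<longleftrightarrow> (s, d) \<in> D"
    "\<And>s. s < r \<Longrightarrow> kohnert_move s D' = D'"
    "\<And>s d. 1 \<le> s \<Longrightarrow> s < r \<Longrightarrow> (s, d) \<notin> D \<Longrightarrow> \<exists>t. 1 \<le> t \<and> t < r \<and> (t, d) \<notin> D'"
    using settle_rows_below[OF diagram_KD[OF assms(1,2)], of r] by metis
  have KD: "D' \<in> KD D\<^sub>0" using assms(2) D'(1) by (auto simp: KD_def)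
  have col: "(s, c) \<in> D'" if "r \<le> s" "s \<le> r'" for s using that assms(10) D'(2) by simp
  have rc': "(r, c') \<in> D'" using assms(11) D'(2) by simp
  have right_r': "(r', d) \<notin> D'" if "c < d" for d using that assms(7,12) D'(2) by simp
  have right_mid: "\<exists>d > c. (s, d) \<in> D'" if "r < s" "s < r'" for s
    using that assms(13) D'(2) by simp
  have right_r: "d = c'" if "c < d" "(r, d) \<in> D'" for d
    using that assms(14) D'(2) by (metis linorder_neqE_nat order_refl)
  obtain s where s: "1 \<le> s" "s < r" "(s, c) \<notin> D'" "\<And>x. s < x \<Longrightarrow> x < r \<Longrightarrow> (x, c) \<in> D'"
    using D'(4)[OF assms(3,4,15)] highest_gap by metis
  obtain t where t: "1 \<le> t" "t < r" "(t, c') \<notin> D'" "\<And>x. t < x \<Longrightarrow> x < r \<Longrightarrow> (x, c') \<in> D'"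
    using D'(4)[OF assms(5,6,16)] highest_gap by metis
  have s_full: "(x, c) \<in> D'" if "s < x" "x < r'" for x
    using that s(4) col by (metis less_imp_le not_le)
  \<comment> \<open>Below \<open>r\<close> the neighbour comes from settledness, in row
    \<open>r\<close> it is \<open>(r, c')\<close>, and above \<open>r\<close> it is given by
    hypothesis.\<close>
  have s_right: "\<exists>d > c. (x, d) \<in> D'" if "s < x" "x < r'" for x
  proof (cases x r rule: linorder_cases)
    case less
    show ?thesis
      by (rule right_neighbour_if_move_trivial[OF D'(3)[OF less] s_full[OF that] s(1) that(1) s(3)])
  next
    case equal
    then show ?thesis using rc' assms(9) by blast
  next
    case greater
    then show ?thesis using right_mid that(2) by simp
  qed
  have t_right: "\<exists>d > c'. (x, d) \<in> D'" if "t < x" "x < r" for x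
    by (rule right_neighbour_if_move_trivial[OF D'(3)[OF that(2)] t(4)[OF that] t(1) that(1) t(3)])
  \<comment> \<open>The short chain is \<open>D'\<close>, \<open>A\<close>, \<open>E\<close>; the
    long one is \<open>D'\<close>, \<open>B\<^sub>1\<close>, \<open>B\<^sub>2\<close>,
    \<open>E\<close>.\<close>
  define A where "A = drop_cell c r' s D'"
  define E where "E = drop_cell c' r t A"
  define B\<^sub>1 where "B\<^sub>1 = drop_cell c' r t D'"
  define B\<^sub>2 where "B\<^sub>2 = drop_cell c r s B\<^sub>1"
  note mem = A_def B\<^sub>1_def B\<^sub>2_def mem_drop_cell
  have A: "covered_by (KD D\<^sub>0) (kohnert_order D\<^sub>0) A D'"
    unfolding A_def
  proof (rule covered_by_drop_cell[OF assms(1) KD])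
    show "(r', c) \<in> D'" using col assms(7) by simp
    show "s < r'" using s(2) assms(7) by simp
  qed (use right_r' s(1,3) s_full s_right in blast)+
  then have A_KD: "A \<in> KD D\<^sub>0"
    unfolding covered_by_def using strictly_below_kohnert_order_KD by blast
  have E: "covered_by (KD D\<^sub>0) (kohnert_order D\<^sub>0) E A"
    unfolding E_def
  proof (rule covered_by_drop_cell[OF assms(1) A_KD])
    show "(r, c') \<in> A" "(t, c') \<notin> A" using rc' t(3) assms(9) by (auto simp: mem)
    show "(r, d) \<notin> A" if "c' < d" for d
      using right_r[of d] that assms(9) by (auto simp: mem)
    show "(x, c') \<in> A" "\<exists>d > c'. (x, d) \<in> A" if "t < x" "x < r" for x
      using t(4)[OF that] t_right[OF that] assms(9) by (auto simp: mem)
  qed (use t(1,2) in auto)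
  then have E_KD: "E \<in> KD D\<^sub>0"
    unfolding covered_by_def using strictly_below_kohnert_order_KD by blast
  have B\<^sub>1: "strictly_below (kohnert_order D\<^sub>0) B\<^sub>1 D'"
    unfolding B\<^sub>1_def
  proof (rule strictly_below_drop_cell[OF assms(1) KD rc'])
    show "(r, d) \<notin> D'" if "c' < d" for d using right_r[of d] that assms(9) by auto
  qed (use t in auto)
  then have B\<^sub>1_KD: "B\<^sub>1 \<in> KD D\<^sub>0" by (rule strictly_below_kohnert_order_KD)
  have B\<^sub>2: "strictly_below (kohnert_order D\<^sub>0) B\<^sub>2 B\<^sub>1"
    unfolding B\<^sub>2_def
  proof (rule strictly_below_drop_cell[OF assms(1) B\<^sub>1_KD])
    show "(r, c) \<in> B\<^sub>1" "(s, c) \<notin> B\<^sub>1"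
      using col[of r] assms(7,9) s(3) by (auto simp: mem)
    \<comment> \<open>The only cell of row \<open>r\<close> to the right of \<open>c\<close> was
      \<open>(r, c')\<close>, which has left the row.\<close>
    show "(r, d) \<notin> B\<^sub>1" if "c < d" for d
      using right_r[OF that] t(2) by (auto simp: mem)
    show "(x, c) \<in> B\<^sub>1" if "s < x" "x < r" for x
      using s(4)[OF that] assms(9) by (auto simp: mem)
  qed (use s(1,2) in auto)
  then have B\<^sub>2_KD: "B\<^sub>2 \<in> KD D\<^sub>0" by (rule strictly_below_kohnert_order_KD)
  \<comment> \<open>In \<open>B\<^sub>2\<close> the cell \<open>(r, c)\<close> has gone to
    \<open>(s, c)\<close>, so the cell from row \<open>r'\<close> stops at \<open>r\<close> and
    refills it. As sets of cells this equals a direct drop from \<open>r'\<close> to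
    \<open>s\<close>.\<close>
  have "E = drop_cell c r' r B\<^sub>2"
    using col[of r] assms(7,9) s(2) t(2) unfolding E_def set_eq_iff
    by (auto simp: mem)
  moreover have "strictly_below (kohnert_order D\<^sub>0) (drop_cell c r' r B\<^sub>2) B\<^sub>2"
  proof (rule strictly_below_drop_cell[OF assms(1) B\<^sub>2_KD])
    show "(r', c) \<in> B\<^sub>2" "(r, c) \<notin> B\<^sub>2"
      using col[of r'] assms(7,9) s(2) by (auto simp: mem)
    show "(r', d) \<notin> B\<^sub>2" if "c < d" for d
      using right_r'[OF that] that assms(7) t(2) by (auto simp: mem)
    show "(x, c) \<in> B\<^sub>2" if "r < x" "x < r'" for x
      using col[of x] that assms(9) by (auto simp: mem)
  qed (use assms(4,7) in auto)
  ultimately have EB: "strictly_below (kohnert_order D\<^sub>0) E B\<^sub>2" by simp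
  show ?thesis
  proof
    assume "ranked (KD D\<^sub>0) (kohnert_order D\<^sub>0)"
    then obtain \<rho> :: "cell set \<Rightarrow> nat" where
      lt: "\<And>x y. x \<in> KD D\<^sub>0 \<Longrightarrow> y \<in> KD D\<^sub>0 \<Longrightarrow> strictly_below (kohnert_order D\<^sub>0) x y \<Longrightarrow> \<rho> x < \<rho> y"
      and cov: "\<And>x y. x \<in> KD D\<^sub>0 \<Longrightarrow> y \<in> KD D\<^sub>0 \<Longrightarrow> covered_by (KD D\<^sub>0) (kohnert_order D\<^sub>0) x y
        \<Longrightarrow> \<rho> y = \<rho> x + 1"
      unfolding ranked_def by blast
    \<comment> \<open>The two covers fix the rank difference at 2, while the long chain forces at
      least 3.\<close>
    have "\<rho> D' = \<rho> E + 2"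
      using cov[OF A_KD KD A] cov[OF E_KD A_KD E] by simp
    moreover have "\<rho> E < \<rho> B\<^sub>2" "\<rho> B\<^sub>2 < \<rho> B\<^sub>1" "\<rho> B\<^sub>1 < \<rho> D'"
      using lt[OF E_KD B\<^sub>2_KD EB] lt[OF B\<^sub>2_KD B\<^sub>1_KD B\<^sub>2] lt[OF B\<^sub>1_KD KD B\<^sub>1] by simp_all
    ultimately show False by linarith
  qed
qed

end
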